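(* Let $A=(a_{i,j})$ be any $r\times r$ symmetrisable generalised Cartan matrix and let $S$ be any semi-ring. For $f\in \mathrm{Frieze}(A,S)$ define $p_{A,S}(f):[1,r]\times\mathbb{Z}\to S$ by \[ p_{A,S}(f)(i,m)=\prod_{j=i+1}^r f(j,m)^{-a_{j,i}}\;\prod_{j=1}^{i-1} f(j,m+1)^{-a_{j,i}}. \] Then $p_{A,S}(f)\in \mathrm{YFrieze}(A,S)$ for every $f\in\mathrm{Frieze}(A,S)$; that is, $p_{A,S}$ is a well-defined map $\mathrm{Frieze}(A,S)\to\mathrm{YFrieze}(A,S)$.
   Context: A symmetrisable generalised Cartan matrix is an integer $r\times r$ matrix $A=(a_{i,j})$ with $a_{i,i}=2$, $a_{i,j}\le 0$ for $i\ne j$, $a_{i,j}=0$ iff $a_{j,i}=0$, and such that $DA$ is symmetric for some diagonal matrix $D$ with positive diagonal entries. A semi-ring $(S,\cdot,+)$ is a set with an associative commutative multiplication having identity $1$, an associative commutative addition (no zero element required), and distributivity $(a+b)c=ac+bc$. Since $-a_{j,i}\ge 0$ for $j\neq i$, all products above are products of nonnegative powers (empty products and zeroth powers equal $1$). An $S$-valued frieze pattern associated to $A$ is a map $f:[1,r]\times\mathbb{Z}\to S$ with \[ f(i,m)f(i,m+1)=1+\prod_{j=i+1}^r f(j,m)^{-a_{j,i}}\prod_{j=1}^{i-1}f(j,m+1)^{-a_{j,i}}\quad\forall (i,m). \] An $S$-valued $\mathbf{Y}$-frieze pattern associated to $A$ is a map $k:[1,r]\times\mathbb{Z}\to S$ with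 \[ k(i,m)k(i,m+1)=\prod_{j=i+1}^r (1+k(j,m))^{-a_{j,i}}\prod_{j=1}^{i-1}(1+k(j,m+1))^{-a_{j,i}}\quad\forall (i,m). \] $\mathrm{Frieze}(A,S)$ and $\mathrm{YFrieze}(A,S)$ denote the sets of these. *)

theory Defs
  imports Complex_Main "HOL-Library.FuncSet"
begin

text \<open>
  An \<open>r\<close> by \<open>r\<close> integer matrix is a function \<open>nat \<Rightarrow> nat \<Rightarrow> int\<close> read on the index set \<open>{1..r}\<close>.
  In the last clause \<open>d\<close> is the diagonal of \<open>D\<close>, so that \<open>d i * a i j\<close> is the \<open>(i, j)\<close> entry of
  \<open>D A\<close>; the entries of \<open>D\<close> are allowed to be arbitrary positive reals.
\<close>

definition symmetrisable_GCM :: "nat \<Rightarrow> (nat \<Rightarrow> nat \<Rightarrow> int) \<Rightarrow> bool" where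
  "symmetrisable_GCM r a \<longleftrightarrow>
     (\<forall>i\<in>{1..r}. a i i = 2) \<and>
     (\<forall>i\<in>{1..r}. \<forall>j\<in>{1..r}. i \<noteq> j \<longrightarrow> a i j \<le> 0) \<and>
     (\<forall>i\<in>{1..r}. \<forall>j\<in>{1..r}. a i j = 0 \<longleftrightarrow> a j i = 0) \<and>
     (\<exists>d :: nat \<Rightarrow> real. (\<forall>i\<in>{1..r}. d i > 0) \<and>
        (\<forall>i\<in>{1..r}. \<forall>j\<in>{1..r}. d i * of_int (a i j) = d j * of_int (a j i)))"

text \<open>
  A semi-ring (commutative, with \<open>1\<close> but not necessarily with \<open>0\<close>) is a type of sort
  \<open>{comm_semiring, comm_monoid_mult}\<close>.

  Maps on \<open>[1, r] \<times> \<int>\<close> are represented by extensional functions on \<open>{1..r} \<times> UNIV\<close>, so that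
  \<open>Frieze\<close> and \<open>YFrieze\<close> are literally sets of maps with this domain. The exponents
  \<open>- a j i\<close> only occur for \<open>j \<noteq> i\<close>, where they are nonnegative; \<open>nat\<close> does not truncate there.
\<close>

definition Frieze ::
  "nat \<Rightarrow> (nat \<Rightarrow> nat \<Rightarrow> int) \<Rightarrow> (nat \<times> int \<Rightarrow> 's :: {comm_semiring, comm_monoid_mult}) set" where
  "Frieze r a = {f \<in> {1..r} \<times> UNIV \<rightarrow>\<^sub>E UNIV. \<forall>i\<in>{1..r}. \<forall>m.
     f (i, m) * f (i, m + 1) =
       1 + (\<Prod>j\<in>{i+1..r}. f (j, m) ^ nat (- a j i)) *
           (\<Prod>j\<in>{1..<i}. f (j, m + 1) ^ nat (- a j i))}"

definition YFrieze ::
  "nat \<Rightarrow> (nat \<Rightarrow> nat \<Rightarrow> int) \<Rightarrow> (nat \<times> int \<Rightarrow> 's :: {comm_semiring, comm_monoid_mult}) set" where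
  "YFrieze r a = {k \<in> {1..r} \<times> UNIV \<rightarrow>\<^sub>E UNIV. \<forall>i\<in>{1..r}. \<forall>m.
     k (i, m) * k (i, m + 1) =
       (\<Prod>j\<in>{i+1..r}. (1 + k (j, m)) ^ nat (- a j i)) *
       (\<Prod>j\<in>{1..<i}. (1 + k (j, m + 1)) ^ nat (- a j i))}"

definition p_map ::
  "nat \<Rightarrow> (nat \<Rightarrow> nat \<Rightarrow> int) \<Rightarrow> (nat \<times> int \<Rightarrow> 's :: {comm_semiring, comm_monoid_mult}) \<Rightarrow>
   (nat \<times> int \<Rightarrow> 's)" where
  "p_map r a f = (\<lambda>(i, m)\<in>{1..r} \<times> UNIV.
     (\<Prod>j\<in>{i+1..r}. f (j, m) ^ nat (- a j i)) *
     (\<Prod>j\<in>{1..<i}. f (j, m + 1) ^ nat (- a j i)))"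

end

theory Submission
  imports Defs
begin

text \<open>The frieze relation says exactly that 1 + p(f)(j,m) = f(j,m) f(j,m+1)
  (\<open>one_plus_p_map\<close>). Substituting this into the right-hand side of the Y-frieze
  relation splits each of its two products into one taken at a time and one taken a step later. The
  four pieces regroup as p(f)(i,m) p(f)(i,m+1), with no subtraction or division.\<close>

lemma one_plus_p_map:
  assumes "f \<in> Frieze r a" "i \<in> {1..r}"
  shows "1 + p_map r a f (i, m) = f (i, m) * f (i, m + 1)"
  using assms by (simp add: Frieze_def p_map_def)

theorem theorem2p8:
  fixes r :: nat and a :: "nat \<Rightarrow> nat \<Rightarrow> int"
  assumes "symmetrisable_GCM r a"
  shows "(p_map r a :: (nat \<times> int \<Rightarrow> 's :: {comm_semiring, comm_monoid_mult}) \<Rightarrow> (nat \<times> int \<Rightarrow> 's))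
           \<in> Frieze r a \<rightarrow> YFrieze r a"
proof
  fix f :: "nat \<times> int \<Rightarrow> 's"
  assume f: "f \<in> Frieze r a"
  have "p_map r a f (i, m) * p_map r a f (i, m + 1) =
      (\<Prod>j\<in>{i+1..r}. (1 + p_map r a f (j, m)) ^ nat (- a j i)) *
      (\<Prod>j\<in>{1..<i}. (1 + p_map r a f (j, m + 1)) ^ nat (- a j i))"
    if i: "i \<in> {1..r}" for i m
  proof -
    have upper: "(\<Prod>j\<in>{i+1..r}. (1 + p_map r a f (j, m)) ^ nat (- a j i)) =
        (\<Prod>j\<in>{i+1..r}. f (j, m) ^ nat (- a j i)) *
        (\<Prod>j\<in>{i+1..r}. f (j, m + 1) ^ nat (- a j i))"
      unfolding prod.distrib [symmetric]
      by (intro prod.cong) (simp_all add: one_plus_p_map [OF f] power_mult_distrib)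
    have lower: "(\<Prod>j\<in>{1..<i}. (1 + p_map r a f (j, m + 1)) ^ nat (- a j i)) =
        (\<Prod>j\<in>{1..<i}. f (j, m + 1) ^ nat (- a j i)) *
        (\<Prod>j\<in>{1..<i}. f (j, m + 1 + 1) ^ nat (- a j i))"
      unfolding prod.distrib [symmetric]
      \<comment> \<open>The bound i \<le> r is what puts each j < i into the index set.\<close>
      using i by (intro prod.cong) (simp_all add: one_plus_p_map [OF f] power_mult_distrib)
    show ?thesis
      \<comment> \<open>Pair \<open>upper\<close> at m with \<open>lower\<close> at m+1, and
        \<open>upper\<close> at m+1 with \<open>lower\<close> at m+2.\<close>
      unfolding upper lower using i by (simp add: p_map_def mult_ac)
  qed
  then show "p_map r a f \<in> YFrieze r a"
    \<comment> \<open>The relation is matched with \<open>p_map\<close> still folded; its definition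
      then gives extensionality.\<close>
    by (simp add: YFrieze_def) (simp add: p_map_def)
qed

end
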